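(* Let $|\psi\rangle=c_1|00\rangle+c_2|01\rangle+c_3|10\rangle+c_4|11\rangle$, with $c_i\in\mathbb{C}$ and $\sum_{i=1}^4|c_i|^2=1$, be an arbitrary two-qubit pure state. The success probability of transforming 4 copies of $|\psi\rangle$ into $\phi^+$ using a universal conclusive ECP based on concatenated two-qubit operations is bounded by $$P_{\psi^{\otimes4}\to\phi^+}\le 2\left|c_2^4c_3^4\right|+2\left|c_1^4c_4^4\right|-4\,\mathrm{Re}\left[c_1^2c_4^2(c_2^* )^2(c_3^* )^2\right].$$
   Context: For a pure state $|\psi\rangle$ write $\psi=|\psi\rangle\langle\psi|$; $|\phi^+\rangle=(|00\rangle+|11\rangle)/\sqrt2$. Each copy of the two-qubit state is shared between Alice and Bob, and LOCC is with respect to the Alice/Bob cut. A completely positive trace non-increasing LOCC map $\mathcal{E}_1$ (a success branch, completed to a trace-preserving map by another such LOCC map) taking $n$ copies to one two-qubit state is a universal conclusive ECP (entanglement concentration protocol) over a set $\mathcal{S}$ of states if $\langle\phi^+|\mathcal{E}_1(\rho^{\otimes n})|\phi^+\rangle=\operatorname{Tr}[\mathcal{E}_1(\rho^{\otimes n})]$ for all $\rho\in\mathcal{S}$; its success probability is $\operatorname{Tr}[\mathcal{E}_1(\rho^{\otimes n})]$. Here $n=4$ and $\mathcal{S}$ is the set of all pure two-qubit states (no knowledge of the Schmidt basis). "Based on concatenated two-qubit operations" means the following two-stage structure, in which each party acts jointly on only two qubits at a time. Stage 1: the four copies are grouped into two pairs, and to each pair $|\psi\rangle_{AB}\otimes|\psi\rangle_{A'B'}$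 the same universal LOCC map $\mathcal{E}_S(\cdot)=\sum_iM_i(\cdot)M_i^\dagger$ (completely positive, trace non-increasing) is applied, which on success outputs a pure state with the fixed known Schmidt basis $\{|00\rangle,|11\rangle\}$, i.e. $\alpha|00\rangle_{AB}+\beta|11\rangle_{AB}$ with input-dependent coefficients (times a product garbage state on $A'B'$ that is discarded). It is required that $M_i=K_i\otimes K_i$ on $\mathcal{H}_{AA'}\otimes\mathcal{H}_{BB'}$ and that product inputs do not lead to success. Such maps are those with $$K_i=a(|00\rangle\langle01|+|00\rangle\langle10|)+b(|10\rangle\langle01|-|10\rangle\langle10|),$$ where $a,b$ are non-zero complex numbers with $2(|a|^4+|b|^4)\le1$ (kets on Alice's pair $AA'$, respectively Bob's pair $BB'$). Stage 2: to the two identical (renormalized) output states of Stage 1, a universal conclusive ECP for two copies over the set of states $\alpha|00\rangle+\beta|11\rangle$ is applied; the optimal one succeeds with probability $2|\alpha\beta|^2$. The whole protocol succeeds iff both Stage 1 applications and Stage 2 succeed: $P_{\psi^{\otimes4}\to\phi^+}=(P')^2P''$, where $P'$ is the success probability of each Stage 1 application and $P''$ is that of Stage 2 on the renormalized states. *)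

theory Defs
  imports Complex_Main "Jordan_Normal_Form.Schur_Decomposition"
begin

section \<open>Finite-dimensional states and operators\<close>

definition mat_trace :: "complex mat \<Rightarrow> complex" where
  "mat_trace X = (\<Sum>i<dim_row X. X $$ (i, i))"

definition proj :: "complex vec \<Rightarrow> complex mat" where
  "proj v = mat (dim_vec v) (dim_vec v) (\<lambda>(i, j). v $ i * cnj (v $ j))"

definition vec_kron :: "complex vec \<Rightarrow> complex vec \<Rightarrow> complex vec" where
  "vec_kron v w = vec (dim_vec v * dim_vec w)
     (\<lambda>i. v $ (i div dim_vec w) * w $ (i mod dim_vec w))"

definition mat_kron :: "complex mat \<Rightarrow> complex mat \<Rightarrow> complex mat" where
  "mat_kron A B = mat (dim_row A * dim_row B) (dim_col A * dim_col B)
     (\<lambda>(i, j). A $$ (i div dim_row B, j div dim_col B) * B $$ (i mod dim_row B, j mod dim_col B))"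

text \<open>A bipartite system with local dimensions \<open>a\<close> (Alice) and \<open>b\<close> (Bob) is indexed by
  \<open>i * b + j\<close>, that is, Alice's index is the more significant one. Placing a second bipartite system
  with local dimensions \<open>a'\<close> and \<open>b'\<close> beside it requires a reordering that keeps the Alice/Bob cut:
  if \<open>p\<close> is an index of \<open>AB\<close> and \<open>q\<close> an index of \<open>A'B'\<close>, then \<open>cut_index\<close> is the position of the
  joint basis vector in the order \<open>A A' | B B'\<close>; \<open>cut_fst\<close> and \<open>cut_snd\<close> recover \<open>p\<close> and \<open>q\<close>.\<close>

definition cut_index :: "nat \<Rightarrow> nat \<Rightarrow> nat \<Rightarrow> nat \<Rightarrow> nat \<Rightarrow> nat" where
  "cut_index b a' b' p q =
     ((p div b) * a' + q div b') * (b * b') + ((p mod b) * b' + q mod b')"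

definition cut_fst :: "nat \<Rightarrow> nat \<Rightarrow> nat \<Rightarrow> nat \<Rightarrow> nat" where
  "cut_fst b a' b' r = (r div (b * b') div a') * b + r mod (b * b') div b'"

definition cut_snd :: "nat \<Rightarrow> nat \<Rightarrow> nat \<Rightarrow> nat \<Rightarrow> nat" where
  "cut_snd b a' b' r = (r div (b * b') mod a') * b' + r mod (b * b') mod b'"

definition cut_tensor ::
    "nat \<Rightarrow> nat \<Rightarrow> nat \<Rightarrow> nat \<Rightarrow> complex mat \<Rightarrow> complex mat \<Rightarrow> complex mat" where
  "cut_tensor a b a' b' X Y = mat (a * a' * (b * b')) (a * a' * (b * b'))
     (\<lambda>(r, s). X $$ (cut_fst b a' b' r, cut_fst b a' b' s)
             * Y $$ (cut_snd b a' b' r, cut_snd b a' b' s))"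

text \<open>Partial trace over \<open>A'B'\<close> of an operator on \<open>A A' | B B'\<close>.\<close>

definition discard_snd :: "nat \<Rightarrow> nat \<Rightarrow> nat \<Rightarrow> nat \<Rightarrow> complex mat \<Rightarrow> complex mat" where
  "discard_snd a b a' b' X = mat (a * b) (a * b)
     (\<lambda>(p, p'). \<Sum>q<a' * b'. X $$ (cut_index b a' b' p q, cut_index b a' b' p' q))"

fun copies :: "nat \<Rightarrow> complex mat \<Rightarrow> complex mat" where
  "copies 0 \<rho> = 1\<^sub>m 1"
| "copies (Suc n) \<rho> = cut_tensor 2 2 (2 ^ n) (2 ^ n) \<rho> (copies n \<rho>)"

definition phi_plus :: "complex vec" where
  "phi_plus = vec_of_list [1 / sqrt 2, 0, 0, 1 / sqrt 2]"


section \<open>LOCC\<close>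

definition measurement :: "nat \<Rightarrow> complex mat list \<Rightarrow> bool" where
  "measurement d Ks \<longleftrightarrow> (\<forall>K\<in>set Ks. dim_col K = d) \<and>
     foldr (\<lambda>K X. mat_adjoint K * K + X) Ks (0\<^sub>m d d) = 1\<^sub>m d"

text \<open>\<open>locc eA eB dA dB L\<close>: \<open>L\<close> lists the product Kraus operators \<open>A \<otimes> B\<close>, given as pairs, of all
  branches of a finite-round LOCC protocol from local dimensions \<open>dA\<close>, \<open>dB\<close> to \<open>eA\<close>, \<open>eB\<close>.
  In each round one party performs a complete measurement, whose outcomes may have
  different output dimensions, and the continuation depends on the outcome. Since measurements may be
  arbitrarily fine-grained, protocols that forget outcomes or discard
  subsystems are obtained by grouping branches.\<close>

inductive locc :: "nat \<Rightarrow> nat \<Rightarrow> nat \<Rightarrow> nat \<Rightarrow> (complex mat \<times> complex mat) list \<Rightarrow> bool"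
  for eA eB where
  stop: "locc eA eB eA eB [(1\<^sub>m eA, 1\<^sub>m eB)]"
| alice: "measurement dA Ks \<Longrightarrow> list_all2 (\<lambda>K L. locc eA eB (dim_row K) dB L) Ks Ls \<Longrightarrow>
    locc eA eB dA dB (concat (map2 (\<lambda>K L. map (\<lambda>(A, B). (A * K, B)) L) Ks Ls))"
| bob: "measurement dB Ks \<Longrightarrow> list_all2 (\<lambda>K L. locc eA eB dA (dim_row K) L) Ks Ls \<Longrightarrow>
    locc eA eB dA dB (concat (map2 (\<lambda>K L. map (\<lambda>(A, B). (A, B * K)) L) Ks Ls))"

definition kraus_map ::
    "nat \<Rightarrow> nat \<Rightarrow> (complex mat \<times> complex mat) list \<Rightarrow> complex mat \<Rightarrow> complex mat" where
  "kraus_map eA eB L \<rho> =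
     foldr (\<lambda>(A, B) X. mat_kron A B * \<rho> * mat_adjoint (mat_kron A B) + X) L
       (0\<^sub>m (eA * eB) (eA * eB))"

text \<open>A success branch: a group \<open>S\<close> of the branches of an LOCC protocol. The remaining branches
  complete it to a trace-preserving map.\<close>

definition locc_branch ::
    "nat \<Rightarrow> nat \<Rightarrow> nat \<Rightarrow> nat \<Rightarrow> (complex mat \<Rightarrow> complex mat) \<Rightarrow> bool" where
  "locc_branch dA dB eA eB E \<longleftrightarrow> (\<exists>L S. locc eA eB dA dB L \<and>
     (\<forall>\<rho> \<in> carrier_mat (dA * dB) (dA * dB). E \<rho> = kraus_map eA eB (nths L S) \<rho>))"


section \<open>Universal conclusive entanglement concentration\<close>

definition universal_conclusive_ecp ::
    "nat \<Rightarrow> complex mat set \<Rightarrow> (complex mat \<Rightarrow> complex mat) \<Rightarrow> bool" where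
  "universal_conclusive_ecp n S E \<longleftrightarrow> locc_branch (2 ^ n) (2 ^ n) 2 2 E \<and>
     (\<forall>\<rho>\<in>S. (E (copies n \<rho>) *\<^sub>v phi_plus) \<bullet>c phi_plus = mat_trace (E (copies n \<rho>)))"

definition schmidt_ket :: "complex \<Rightarrow> complex \<Rightarrow> complex vec" where
  "schmidt_ket \<alpha> \<beta> = vec_of_list [\<alpha>, 0, 0, \<beta>]"

definition known_basis_states :: "complex mat set" where
  "known_basis_states =
     {proj (schmidt_ket \<alpha> \<beta>) | \<alpha> \<beta>. (cmod \<alpha>)\<^sup>2 + (cmod \<beta>)\<^sup>2 = 1}"


section \<open>Concatenated two-qubit operations\<close>

text \<open>\<open>a (|00><01| + |00><10|) + b (|10><01| - |10><10|)\<close> in the basis 00, 01, 10, 11 of one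
  party's qubit pair.\<close>

definition stage1_op :: "complex \<Rightarrow> complex \<Rightarrow> complex mat" where
  "stage1_op a b = mat_of_rows_list 4
     [[0, a, a, 0],
      [0, 0, 0, 0],
      [0, b, -b, 0],
      [0, 0, 0, 0]]"

definition stage1_map :: "complex mat list \<Rightarrow> complex mat \<Rightarrow> complex mat" where
  "stage1_map Ks = kraus_map 4 4 (map (\<lambda>K. (K, K)) Ks)"

text \<open>In the last clause \<open>\<alpha>\<close> and \<open>\<beta>\<close> are not normalized: the squared norm of the output is
  the success probability. A product input does get mapped to a nonzero output in general,
  but to an unentangled one, from which Stage 2 cannot succeed.\<close>

definition stage1 :: "complex mat list \<Rightarrow> bool" where
  "stage1 Ks \<longleftrightarrow>
     locc_branch 4 4 4 4 (stage1_map Ks) \<and>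
     (\<forall>K\<in>set Ks. \<exists>a b. a \<noteq> 0 \<and> b \<noteq> 0 \<and> 2 * (cmod a ^ 4 + cmod b ^ 4) \<le> 1 \<and> K = stage1_op a b) \<and>
     (\<forall>\<psi> \<in> carrier_vec 4. \<psi> \<bullet>c \<psi> = 1 \<longrightarrow>
        (\<exists>\<alpha> \<beta>. \<exists>g \<in> carrier_vec 2. \<exists>h \<in> carrier_vec 2. g \<bullet>c g = 1 \<and> h \<bullet>c h = 1 \<and>
           stage1_map Ks (copies 2 (proj \<psi>)) =
             cut_tensor 2 2 2 2 (proj (schmidt_ket \<alpha> \<beta>)) (proj (vec_kron g h)) \<and>
           ((\<exists>x \<in> carrier_vec 2. \<exists>y \<in> carrier_vec 2. \<psi> = vec_kron x y) \<longrightarrow> \<alpha> = 0 \<or> \<beta> = 0)))"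

definition stage1_prob :: "complex mat list \<Rightarrow> complex vec \<Rightarrow> real" where
  "stage1_prob Ks \<psi> = Re (mat_trace (stage1_map Ks (copies 2 (proj \<psi>))))"

text \<open>If the success probability is zero, the renormalized state below is the junk value 0. This
  is harmless, as the total success probability is then zero as well.\<close>

definition stage1_output :: "complex mat list \<Rightarrow> complex vec \<Rightarrow> complex mat" where
  "stage1_output Ks \<psi> = complex_of_real (1 / stage1_prob Ks \<psi>) \<cdot>\<^sub>m
     discard_snd 2 2 2 2 (stage1_map Ks (copies 2 (proj \<psi>)))"

definition stage2_prob ::
    "complex mat list \<Rightarrow> (complex mat \<Rightarrow> complex mat) \<Rightarrow> complex vec \<Rightarrow> real" where
  "stage2_prob Ks E \<psi> = Re (mat_trace (E (copies 2 (stage1_output Ks \<psi>))))"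

text \<open>A protocol on four copies: the same Stage 1 map, given by \<open>Ks\<close>, on each of two pairs of copies,
  followed by the Stage 2 map \<open>E\<close> on the two outputs.\<close>

definition concatenated_ecp :: "complex mat list \<Rightarrow> (complex mat \<Rightarrow> complex mat) \<Rightarrow> bool" where
  "concatenated_ecp Ks E \<longleftrightarrow> stage1 Ks \<and> universal_conclusive_ecp 2 known_basis_states E"

definition success_prob ::
    "complex mat list \<Rightarrow> (complex mat \<Rightarrow> complex mat) \<Rightarrow> complex vec \<Rightarrow> real" where
  "success_prob Ks E \<psi> = (stage1_prob Ks \<psi>)\<^sup>2 * stage2_prob Ks E \<psi>"

end

(* With x = c1 c4 + c2 c3 and y = c1 c4 - c2 c3 the bound is 2 |x y|^2. A Kraus operator of Stage 1 with
   parameters a, b maps two copies to 2 a^2 x |00> + 2 b^2 y |11>; so the coherence alpha * cnj beta of the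
   unnormalized Stage 1 output is at most the sum of 4 |a b|^2 times |x y|, and that sum is at most 1
   because LOCC success branches do not increase the trace. In Stage 2, a conclusive branch must
   annihilate |00,00> and |11,11> (take beta = 0 or alpha = 0: a product vector has product image, which
   is proportional to phi^+ only if it vanishes), so it sees only alpha beta (|01,01> + |10,10>) and
   trace non-increase gives at most 2 |alpha beta|^2. The normalization of Stage 1 cancels. *)

theory Submission
  imports Defs
begin

section \<open>Trace preservation of LOCC protocols\<close>

text \<open>Splits the flat index of a bipartite system into Alice's and Bob's indices inside a
  sum.\<close>

lemma sum_div_mod:
  "(\<Sum>r<m * n. f (r div n) (r mod n)) = (\<Sum>i<m. \<Sum>j<(n::nat). f i j)"
proof -
  have "(\<Sum>r<m * n. f (r div n) (r mod n)) = (\<Sum>(i, j)\<in>{..<m} \<times> {..<n}. f i j)"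
  proof (rule sum.reindex_bij_witness[where j = "\<lambda>r. (r div n, r mod n)" and i = "\<lambda>(i, j). i * n + j"])
    fix r assume r: "r \<in> {..<m * n}"
    then have "n > 0" by (cases n) auto
    then show "(r div n, r mod n) \<in> {..<m} \<times> {..<n}"
      using r by (auto simp: less_mult_imp_div_less)
  next
    fix p assume p: "p \<in> {..<m} \<times> {..<n}"
    then obtain i j where ij: "p = (i, j)" "i < m" "j < n" by auto
    then have "i * n + j < Suc i * n" by simp
    also have "\<dots> \<le> m * n" using ij by (intro mult_le_mono1) simp
    finally show "(case p of (i, j) \<Rightarrow> i * n + j) \<in> {..<m * n}" using ij by simp
  qed auto
  then show ?thesis by (simp add: sum.cartesian_product)
qed

lemma dim_mat_adjoint [simp]:
  "dim_row (mat_adjoint X) = dim_col X" "dim_col (mat_adjoint X) = dim_row X"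
  by (simp_all add: mat_adjoint_def)

lemma index_mat_adjoint [simp]:
  fixes X :: "complex mat"
  shows "i < dim_col X \<Longrightarrow> j < dim_row X \<Longrightarrow> mat_adjoint X $$ (i, j) = cnj (X $$ (j, i))"
  by (simp add: mat_adjoint_def mat_of_rows_index)

lemma adjoint_carrier: "X \<in> carrier_mat n m \<Longrightarrow> mat_adjoint X \<in> carrier_mat m n"
  by auto

lemma mat_adjoint_mult:
  fixes X Y :: "complex mat"
  assumes "dim_col X = dim_row Y"
  shows "mat_adjoint (X * Y) = mat_adjoint Y * mat_adjoint X"
  by (rule eq_matI) (use assms in \<open>auto simp: scalar_prod_def mult.commute\<close>)

lemma mat_trace_add:
  "X \<in> carrier_mat n n \<Longrightarrow> Y \<in> carrier_mat n n \<Longrightarrow> mat_trace (X + Y) = mat_trace X + mat_trace Y"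
  by (auto simp: mat_trace_def sum.distrib)

text \<open>Bipartite vectors are handled as coefficient matrices, on which \<open>A \<otimes> B\<close> acts by
  \<open>V \<mapsto> A V B\<^sup>T\<close>; \<open>frob\<close> is the squared norm.\<close>

definition frob :: "complex mat \<Rightarrow> real" where
  "frob V = (\<Sum>i<dim_row V. \<Sum>j<dim_col V. (cmod (V $$ (i, j)))\<^sup>2)"

lemma frob_nonneg: "frob V \<ge> 0"
  by (simp add: frob_def sum_nonneg)

lemma frob_transpose: "frob (transpose_mat V) = frob V"
proof -
  have "frob V = (\<Sum>j<dim_col V. \<Sum>i<dim_row V. (cmod (V $$ (i, j)))\<^sup>2)"
    unfolding frob_def by (rule sum.swap)
  then show ?thesis by (simp add: frob_def)
qed

text \<open>In trace form the squared norm is linear in an operator inserted between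
  \<open>mat_adjoint V\<close> and \<open>V\<close>; this is where the completeness relation of a
  measurement enters.\<close>

lemma frob_eq_trace: "complex_of_real (frob V) = mat_trace (mat_adjoint V * V)"
proof -
  have "complex_of_real (frob V) =
      (\<Sum>j<dim_col V. \<Sum>i<dim_row V. complex_of_real ((cmod (V $$ (i, j)))\<^sup>2))"
    unfolding frob_def of_real_sum by (rule sum.swap)
  also have "\<dots> = mat_trace (mat_adjoint V * V)"
    by (simp add: mat_trace_def scalar_prod_def complex_norm_square mult.commute atLeast0LessThan
        flip: of_real_power del: of_real_power)
  finally show ?thesis .
qed

text \<open>Summed over the outcomes, the operators \<open>mat_adjoint K * K\<close> between
  \<open>mat_adjoint V\<close> and \<open>V\<close> add up to the identity.\<close>

lemma measurement_frob:
  assumes "measurement d Ks" and V: "V \<in> carrier_mat d e"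
  shows "(\<Sum>K\<leftarrow>Ks. frob (K * V)) = frob V"
proof -
  let ?S = "\<lambda>Ks. foldr (\<lambda>K X. mat_adjoint K * K + X) Ks (0\<^sub>m d d)"
  \<comment> \<open>A tail of a complete measurement is not complete, so the induction carries the
    partial sum \<open>?S Ks\<close> and inserts completeness only afterwards.\<close>
  have "?S Ks \<in> carrier_mat d d \<and>
      mat_trace (mat_adjoint V * ?S Ks * V) = complex_of_real (\<Sum>K\<leftarrow>Ks. frob (K * V))"
    if "\<forall>K\<in>set Ks. dim_col K = d" for Ks
    using that
  proof (induction Ks)
    case Nil
    have "mat_adjoint V * 0\<^sub>m d d * V = 0\<^sub>m e e"
      using V by (auto intro!: eq_matI)
    then show ?case by (simp add: mat_trace_def)
  next
    case (Cons K Ks)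
    then have IH: "?S Ks \<in> carrier_mat d d"
        "mat_trace (mat_adjoint V * ?S Ks * V) = complex_of_real (\<Sum>K\<leftarrow>Ks. frob (K * V))"
      by auto
    define k where "k = dim_row K"
    have K: "K \<in> carrier_mat k d" using Cons.prems by (auto simp: k_def)
    have K': "mat_adjoint K \<in> carrier_mat d k" and V': "mat_adjoint V \<in> carrier_mat e d"
      using K V by auto
    have KK: "mat_adjoint K * K \<in> carrier_mat d d" using K K' by auto
    have "mat_adjoint V * (mat_adjoint K * K + ?S Ks) * V
        = mat_adjoint V * (mat_adjoint K * K) * V + mat_adjoint V * ?S Ks * V"
      using KK V V' IH(1)
      by (simp add: mult_add_distrib_mat[of _ e d _ d] add_mult_distrib_mat[of _ e d _ _ e])
    moreover have "mat_adjoint V * (mat_adjoint K * K) * V = mat_adjoint (K * V) * (K * V)"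
      using K V K' V'
      by (simp add: mat_adjoint_mult assoc_mult_mat[of _ e d _ k _ d]
          assoc_mult_mat[of _ e d _ d _ e] assoc_mult_mat[of _ d k _ d _ e]
          assoc_mult_mat[of _ e d _ k _ e])
    moreover have "mat_adjoint (K * V) * (K * V) \<in> carrier_mat e e"
      by (rule mult_carrier_mat[OF adjoint_carrier]) (rule mult_carrier_mat[OF K V])+
    moreover have "mat_adjoint V * ?S Ks * V \<in> carrier_mat e e"
      by (rule mult_carrier_mat[OF mult_carrier_mat[OF V' IH(1)] V])
    ultimately have "mat_trace (mat_adjoint V * (mat_adjoint K * K + ?S Ks) * V)
        = mat_trace (mat_adjoint (K * V) * (K * V)) + mat_trace (mat_adjoint V * ?S Ks * V)"
      by (simp only: mat_trace_add[of _ e])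
    then show ?case using IH KK by (simp add: frob_eq_trace)
  qed
  from this[of Ks] assms have "complex_of_real (\<Sum>K\<leftarrow>Ks. frob (K * V)) = mat_trace (mat_adjoint V * 1\<^sub>m d * V)"
    by (auto simp: measurement_def)
  also have "mat_adjoint V * 1\<^sub>m d = mat_adjoint V"
    using V by (intro right_mult_one_mat) auto
  finally show ?thesis by (simp flip: frob_eq_trace)
qed

lemma measurement_dim: "measurement d Ks \<Longrightarrow> K \<in> set Ks \<Longrightarrow> dim_col K = d"
  by (auto simp: measurement_def)

text \<open>Each round splits the squared norm among its outcomes, and by induction the continuation
  after each outcome preserves its share. The dimensions are carried along because associativity of
  matrix products needs them.\<close>

lemma locc_dims_frob:
  assumes "locc eA eB dA dB L"
  shows "(\<forall>(A, B)\<in>set L. A \<in> carrier_mat eA dA \<and> B \<in> carrier_mat eB dB) \<and>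
    (\<forall>V \<in> carrier_mat dA dB. (\<Sum>(A, B)\<leftarrow>L. frob (A * V * transpose_mat B)) = frob V)"
  using assms
proof (induction rule: locc.induct)
  case stop
  then show ?case by auto
next
  case (alice dA Ks dB Ls)
  let ?f = "\<lambda>Ks Ls. concat (map2 (\<lambda>K L. map (\<lambda>(A, B). (A * K, B)) L) Ks Ls)"
  let ?P = "\<lambda>dA L. (\<forall>(A, B)\<in>set L. A \<in> carrier_mat eA dA \<and> B \<in> carrier_mat eB dB) \<and>
    (\<forall>V \<in> carrier_mat dA dB. (\<Sum>(A, B)\<leftarrow>L. frob (A * V * transpose_mat B)) = frob V)"
  have IH: "list_all2 (\<lambda>K L. ?P (dim_row K) L) Ks Ls"
    using alice(2) by (rule list_all2_mono) auto
  \<comment> \<open>The inner induction along the outcomes keeps only the column dimension of each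
    operator; completeness of Alice's measurement is applied to the resulting sum at the
    end.\<close>
  have "(\<forall>(A, B)\<in>set (?f Ks Ls). A \<in> carrier_mat eA dA \<and> B \<in> carrier_mat eB dB) \<and>
    (\<forall>V \<in> carrier_mat dA dB. (\<Sum>(A, B)\<leftarrow>?f Ks Ls. frob (A * V * transpose_mat B))
       = (\<Sum>K\<leftarrow>Ks. frob (K * V)))"
    using IH measurement_dim[OF alice(1)]
  proof (induction rule: list_all2_induct)
    case Nil
    then show ?case by simp
  next
    case (Cons K Ks L Ls)
    have K: "K \<in> carrier_mat (dim_row K) dA" using Cons.prems by auto
    have dims: "A \<in> carrier_mat eA (dim_row K)" "B \<in> carrier_mat eB dB" if "(A, B) \<in> set L" for A B
      using Cons.hyps that by auto
    have *: "(\<Sum>(A, B)\<leftarrow>map (\<lambda>(A, B). (A * K, B)) L. frob (A * V * transpose_mat B)) = frob (K * V)"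
      if V: "V \<in> carrier_mat dA dB" for V
    proof -
      have "A * K * V * transpose_mat B = A * (K * V) * transpose_mat B" if "(A, B) \<in> set L" for A B
        unfolding assoc_mult_mat[OF dims(1)[OF that] K V] ..
      then have "(\<Sum>(A, B)\<leftarrow>map (\<lambda>(A, B). (A * K, B)) L. frob (A * V * transpose_mat B))
          = (\<Sum>(A, B)\<leftarrow>L. frob (A * (K * V) * transpose_mat B))"
        unfolding map_map o_def
        by (intro arg_cong[where f = sum_list] map_cong) auto
      also have "\<dots> = frob (K * V)"
        using Cons.hyps mult_carrier_mat[OF K V] by blast
      finally show ?thesis .
    qed
    note IH = Cons.IH[OF Cons.prems[OF list.set_intros(2)]]
    show ?case
    proof (intro conjI ballI)
      fix p assume "p \<in> set (?f (K # Ks) (L # Ls))"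
      then consider "p \<in> set (map (\<lambda>(A, B). (A * K, B)) L)" | "p \<in> set (?f Ks Ls)"
        by (simp only: zip_Cons_Cons list.map concat.simps prod.case set_append Un_iff) blast
      then show "case p of (A, B) \<Rightarrow> A \<in> carrier_mat eA dA \<and> B \<in> carrier_mat eB dB"
      proof cases
        case 1
        then obtain x where x: "x \<in> set L" "p = (case x of (A, B) \<Rightarrow> (A * K, B))"
          unfolding set_map by (rule imageE)
        obtain A B where AB: "x = (A, B)"
          by (rule prod.exhaust)
        note d = dims[OF x(1)[unfolded AB]]
        show ?thesis
          unfolding x(2) AB prod.case using mult_carrier_mat[OF d(1) K] d(2) by (intro conjI)
      next
        case 2
        then show ?thesis
          using conjunct1[OF IH] by (rule bspec[rotated])
      qed
    next
      fix V :: "complex mat" assume "V \<in> carrier_mat dA dB"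
      then show "(\<Sum>(A, B)\<leftarrow>?f (K # Ks) (L # Ls). frob (A * V * transpose_mat B))
          = (\<Sum>K\<leftarrow>K # Ks. frob (K * V))"
        using conjunct2[OF IH]
        by (simp only: zip_Cons_Cons list.map concat.simps prod.case map_append sum_list_append *
            sum_list.Cons)
    qed
  qed
  then show ?case by (auto simp: measurement_frob[OF alice(1)])
next
  case (bob dB Ks dA Ls)
  let ?f = "\<lambda>Ks Ls. concat (map2 (\<lambda>K L. map (\<lambda>(A, B). (A, B * K)) L) Ks Ls)"
  let ?P = "\<lambda>dB L. (\<forall>(A, B)\<in>set L. A \<in> carrier_mat eA dA \<and> B \<in> carrier_mat eB dB) \<and>
    (\<forall>V \<in> carrier_mat dA dB. (\<Sum>(A, B)\<leftarrow>L. frob (A * V * transpose_mat B)) = frob V)"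
  have IH: "list_all2 (\<lambda>K L. ?P (dim_row K) L) Ks Ls"
    using bob(2) by (rule list_all2_mono) auto
  \<comment> \<open>Bob's operator multiplies the coefficient matrix from the right by
    \<open>transpose_mat K\<close>. Transposition turns this into a left action, to which the
    measurement identity applies, without changing the norm.\<close>
  have "(\<forall>(A, B)\<in>set (?f Ks Ls). A \<in> carrier_mat eA dA \<and> B \<in> carrier_mat eB dB) \<and>
    (\<forall>V \<in> carrier_mat dA dB. (\<Sum>(A, B)\<leftarrow>?f Ks Ls. frob (A * V * transpose_mat B))
       = (\<Sum>K\<leftarrow>Ks. frob (K * transpose_mat V)))"
    using IH measurement_dim[OF bob(1)]
  proof (induction rule: list_all2_induct)
    case Nil
    then show ?case by simp
  next
    case (Cons K Ks L Ls)
    have K: "K \<in> carrier_mat (dim_row K) dB" using Cons.prems by auto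
    have KT: "transpose_mat K \<in> carrier_mat dB (dim_row K)"
      using transpose_carrier_mat K by blast
    have dims: "A \<in> carrier_mat eA dA" "B \<in> carrier_mat eB (dim_row K)" if "(A, B) \<in> set L" for A B
      using Cons.hyps that by auto
    have *: "(\<Sum>(A, B)\<leftarrow>map (\<lambda>(A, B). (A, B * K)) L. frob (A * V * transpose_mat B))
        = frob (K * transpose_mat V)"
      if V: "V \<in> carrier_mat dA dB" for V
    proof -
      have "A * V * transpose_mat (B * K) = A * (V * transpose_mat K) * transpose_mat B"
        if "(A, B) \<in> set L" for A B
      proof -
        have BT: "transpose_mat B \<in> carrier_mat (dim_row K) eB"
          using transpose_carrier_mat dims(2)[OF that] by blast
        have AV: "A * V \<in> carrier_mat eA dB"
          by (rule mult_carrier_mat[OF dims(1)[OF that] V])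
        show ?thesis
          unfolding transpose_mult[OF dims(2)[OF that] K] assoc_mult_mat[OF AV KT BT, symmetric]
            assoc_mult_mat[OF dims(1)[OF that] V KT] ..
      qed
      then have "(\<Sum>(A, B)\<leftarrow>map (\<lambda>(A, B). (A, B * K)) L. frob (A * V * transpose_mat B))
          = (\<Sum>(A, B)\<leftarrow>L. frob (A * (V * transpose_mat K) * transpose_mat B))"
        unfolding map_map o_def
        by (intro arg_cong[where f = sum_list] map_cong) auto
      also have "\<dots> = frob (V * transpose_mat K)"
        using Cons.hyps mult_carrier_mat[OF V KT] by blast
      also have "\<dots> = frob (transpose_mat (K * transpose_mat V))"
        by (simp add: transpose_mult[OF K transpose_carrier_mat[THEN iffD2, OF V]])
      finally show ?thesis by (simp add: frob_transpose)
    qed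
    note IH = Cons.IH[OF Cons.prems[OF list.set_intros(2)]]
    show ?case
    proof (intro conjI ballI)
      fix p assume "p \<in> set (?f (K # Ks) (L # Ls))"
      then consider "p \<in> set (map (\<lambda>(A, B). (A, B * K)) L)" | "p \<in> set (?f Ks Ls)"
        by (simp only: zip_Cons_Cons list.map concat.simps prod.case set_append Un_iff) blast
      then show "case p of (A, B) \<Rightarrow> A \<in> carrier_mat eA dA \<and> B \<in> carrier_mat eB dB"
      proof cases
        case 1
        then obtain x where x: "x \<in> set L" "p = (case x of (A, B) \<Rightarrow> (A, B * K))"
          unfolding set_map by (rule imageE)
        obtain A B where AB: "x = (A, B)"
          by (rule prod.exhaust)
        note d = dims[OF x(1)[unfolded AB]]
        show ?thesis
          unfolding x(2) AB prod.case using d(1) mult_carrier_mat[OF d(2) K] by (intro conjI)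
      next
        case 2
        then show ?thesis
          using conjunct1[OF IH] by (rule bspec[rotated])
      qed
    next
      fix V :: "complex mat" assume "V \<in> carrier_mat dA dB"
      then show "(\<Sum>(A, B)\<leftarrow>?f (K # Ks) (L # Ls). frob (A * V * transpose_mat B))
          = (\<Sum>K\<leftarrow>K # Ks. frob (K * transpose_mat V))"
        using conjunct2[OF IH]
        by (simp only: zip_Cons_Cons list.map concat.simps prod.case map_append sum_list_append *
            sum_list.Cons)
    qed
  qed
  moreover have "(\<Sum>K\<leftarrow>Ks. frob (K * transpose_mat V)) = frob V" if "V \<in> carrier_mat dA dB" for V
    using measurement_frob[OF bob(1), of "transpose_mat V" dA] that by (simp add: frob_transpose)
  ultimately show ?case by auto
qed

section \<open>Kraus maps on pure states\<close>

text \<open>Row-major flattening, matching the convention that Alice's index is the more significant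
  one.\<close>

definition vectorize :: "complex mat \<Rightarrow> complex vec" where
  "vectorize V = vec (dim_row V * dim_col V) (\<lambda>r. V $$ (r div dim_col V, r mod dim_col V))"

lemma dim_vectorize [simp]: "dim_vec (vectorize V) = dim_row V * dim_col V"
  by (simp add: vectorize_def)

lemma index_vectorize [simp]:
  "r < dim_row V * dim_col V \<Longrightarrow> vectorize V $ r = V $$ (r div dim_col V, r mod dim_col V)"
  by (simp add: vectorize_def)

lemma index_sandwich:
  fixes A B V :: "complex mat"
  assumes "A \<in> carrier_mat eA dA" "B \<in> carrier_mat eB dB" "V \<in> carrier_mat dA dB" "p < eA" "q < eB"
  shows "(A * V * transpose_mat B) $$ (p, q) =
    (\<Sum>i<dA. \<Sum>j<dB. A $$ (p, i) * B $$ (q, j) * (V $$ (i, j)))"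
proof -
  have "(A * V * transpose_mat B) $$ (p, q) =
      (\<Sum>j<dB. (\<Sum>i<dA. A $$ (p, i) * V $$ (i, j)) * B $$ (q, j))"
    using assms by (simp add: scalar_prod_def atLeast0LessThan del: assoc_mult_mat)
  also have "\<dots> = (\<Sum>j<dB. \<Sum>i<dA. A $$ (p, i) * B $$ (q, j) * (V $$ (i, j)))"
    unfolding sum_distrib_right by (intro sum.cong refl) simp
  also have "\<dots> = (\<Sum>i<dA. \<Sum>j<dB. A $$ (p, i) * B $$ (q, j) * (V $$ (i, j)))"
    by (rule sum.swap)
  finally show ?thesis .
qed

text \<open>The standard vectorization identity, which replaces Kronecker products by products of
  small matrices.\<close>

lemma mat_kron_mult_vectorize:
  assumes "A \<in> carrier_mat eA dA" "B \<in> carrier_mat eB dB" "V \<in> carrier_mat dA dB"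
  shows "mat_kron A B *\<^sub>v vectorize V = vectorize (A * V * transpose_mat B)"
proof (rule eq_vecI)
  show "dim_vec (mat_kron A B *\<^sub>v vectorize V) = dim_vec (vectorize (A * V * transpose_mat B))"
    using assms by (simp add: mat_kron_def)
next
  fix r assume "r < dim_vec (vectorize (A * V * transpose_mat B))"
  then have r: "r < eA * eB" using assms by simp
  then have "eB > 0" by (cases eB) auto
  then have "r div eB < eA" "r mod eB < eB"
    using r by (auto simp: less_mult_imp_div_less)
  moreover have "(mat_kron A B *\<^sub>v vectorize V) $ r =
      (\<Sum>s<dA * dB. A $$ (r div eB, s div dB) * B $$ (r mod eB, s mod dB) * (V $$ (s div dB, s mod dB)))"
    using assms r by (simp add: mat_kron_def scalar_prod_def atLeast0LessThan)
  ultimately show "(mat_kron A B *\<^sub>v vectorize V) $ r = vectorize (A * V * transpose_mat B) $ r"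
    using assms r sum_div_mod[of "\<lambda>i j. A $$ (r div eB, i) * B $$ (r mod eB, j) * (V $$ (i, j))" dB dA]
    by (simp add: index_sandwich[OF assms] del: assoc_mult_mat index_mult_mat(1))
qed

lemma proj_mult_adjoint:
  assumes "M \<in> carrier_mat n m" "v \<in> carrier_vec m"
  shows "M * proj v * mat_adjoint M = proj (M *\<^sub>v v)"
proof (rule eq_matI)
  fix i j assume "i < dim_row (proj (M *\<^sub>v v))" "j < dim_col (proj (M *\<^sub>v v))"
  then have "i < n" "j < n" using assms by (auto simp: proj_def)
  then show "(M * proj v * mat_adjoint M) $$ (i, j) = proj (M *\<^sub>v v) $$ (i, j)"
    using assms
    by (simp add: proj_def scalar_prod_def sum_distrib_left sum_distrib_right mult_ac, intro sum.swap)
qed (use assms in \<open>auto simp: proj_def\<close>)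

abbreviation branch_out :: "complex mat \<Rightarrow> complex mat \<times> complex mat \<Rightarrow> complex mat" where
  "branch_out V x \<equiv> fst x * V * transpose_mat (snd x)"

text \<open>A Kraus operator sends a pure state to a pure state, so the output is a sum of rank-one
  operators, one per branch. The entrywise form lets single coherences be read off.\<close>

lemma kraus_map_proj:
  assumes "\<And>A B. (A, B) \<in> set L \<Longrightarrow> A \<in> carrier_mat eA dA \<and> B \<in> carrier_mat eB dB"
    and V: "V \<in> carrier_mat dA dB"
  shows "kraus_map eA eB L (proj (vectorize V)) = mat (eA * eB) (eA * eB)
    (\<lambda>(p, q). \<Sum>x\<leftarrow>L. branch_out V x $$ (p div eB, p mod eB) * cnj (branch_out V x $$ (q div eB, q mod eB)))"
  using assms(1)
proof (induction L)
  case Nil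
  then show ?case by (auto simp: kraus_map_def)
next
  case (Cons x L)
  obtain A B where x: "x = (A, B)" by (rule prod.exhaust)
  have AB: "A \<in> carrier_mat eA dA" "B \<in> carrier_mat eB dB" using Cons.prems x by auto
  have M: "mat_kron A B \<in> carrier_mat (eA * eB) (dA * dB)" "vectorize V \<in> carrier_vec (dA * dB)"
    using AB V by (auto simp: mat_kron_def carrier_vecI)
  have "kraus_map eA eB (x # L) (proj (vectorize V))
      = proj (vectorize (A * V * transpose_mat B)) + kraus_map eA eB L (proj (vectorize V))"
    by (simp add: kraus_map_def x proj_mult_adjoint[OF M] mat_kron_mult_vectorize[OF AB V])
  moreover have "kraus_map eA eB L (proj (vectorize V)) = mat (eA * eB) (eA * eB)
      (\<lambda>(p, q). \<Sum>x\<leftarrow>L. branch_out V x $$ (p div eB, p mod eB) * cnj (branch_out V x $$ (q div eB, q mod eB)))"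
    by (rule Cons.IH[OF Cons.prems[OF list.set_intros(2)]])
  ultimately show ?case
    using AB V
    by (auto intro!: eq_matI simp: x proj_def simp del: assoc_mult_mat index_mult_mat(1))
qed

lemma mat_trace_kraus_map:
  assumes "\<And>A B. (A, B) \<in> set L \<Longrightarrow> A \<in> carrier_mat eA dA \<and> B \<in> carrier_mat eB dB"
    and V: "V \<in> carrier_mat dA dB"
  shows "mat_trace (kraus_map eA eB L (proj (vectorize V))) =
    complex_of_real (\<Sum>x\<leftarrow>L. frob (branch_out V x))"
proof -
  have "mat_trace (kraus_map eA eB L (proj (vectorize V))) =
      (\<Sum>p<eA * eB. \<Sum>x\<leftarrow>L. complex_of_real ((cmod (branch_out V x $$ (p div eB, p mod eB)))\<^sup>2))"
    by (subst kraus_map_proj[OF assms])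
      (simp_all add: mat_trace_def complex_norm_square del: of_real_power assoc_mult_mat)
  also have "\<dots> = (\<Sum>x\<leftarrow>L. \<Sum>p<eA * eB. complex_of_real ((cmod (branch_out V x $$ (p div eB, p mod eB)))\<^sup>2))"
    by (induction L) (simp_all add: sum.distrib)
  also have "\<dots> = (\<Sum>x\<leftarrow>L. complex_of_real (frob (branch_out V x)))"
  proof (intro arg_cong[where f = sum_list] map_cong refl)
    fix x assume "x \<in> set L"
    then have "fst x \<in> carrier_mat eA dA" "snd x \<in> carrier_mat eB dB"
      using assms(1)[of "fst x" "snd x"] by auto
    then show "(\<Sum>p<eA * eB. complex_of_real ((cmod (branch_out V x $$ (p div eB, p mod eB)))\<^sup>2))
        = complex_of_real (frob (branch_out V x))"
      using sum_div_mod[of "\<lambda>i j. complex_of_real ((cmod (branch_out V x $$ (i, j)))\<^sup>2)" eB eA]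
      by (simp add: frob_def)
  qed
  also have "\<dots> = complex_of_real (\<Sum>x\<leftarrow>L. frob (branch_out V x))"
    by (induction L) simp_all
  finally show ?thesis .
qed

lemma sum_list_nths_le:
  fixes f :: "'a \<Rightarrow> real"
  assumes "\<And>x. f x \<ge> 0"
  shows "(\<Sum>x\<leftarrow>nths xs S. f x) \<le> (\<Sum>x\<leftarrow>xs. f x)"
  by (induction xs arbitrary: S) (auto simp: nths_Cons assms add_increasing)

text \<open>Extracts from an LOCC success branch what the bounds rely on: product Kraus operators of
  the right dimensions and trace non-increase on pure inputs.\<close>

lemma locc_branchE:
  assumes "locc_branch dA dB eA eB E"
  obtains T where
    "\<And>A B. (A, B) \<in> set T \<Longrightarrow> A \<in> carrier_mat eA dA \<and> B \<in> carrier_mat eB dB"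
    "\<And>\<rho>. \<rho> \<in> carrier_mat (dA * dB) (dA * dB) \<Longrightarrow> E \<rho> = kraus_map eA eB T \<rho>"
    "\<And>V. V \<in> carrier_mat dA dB \<Longrightarrow> (\<Sum>x\<leftarrow>T. frob (branch_out V x)) \<le> frob V"
proof -
  obtain L S where L: "locc eA eB dA dB L"
    and E: "\<And>\<rho>. \<rho> \<in> carrier_mat (dA * dB) (dA * dB) \<Longrightarrow> E \<rho> = kraus_map eA eB (nths L S) \<rho>"
    using assms by (auto simp: locc_branch_def)
  show thesis
  proof (rule that[of "nths L S"])
    show "A \<in> carrier_mat eA dA \<and> B \<in> carrier_mat eB dB" if "(A, B) \<in> set (nths L S)" for A B
      using locc_dims_frob[OF L] set_nths_subset[of L S] that by fastforce
    show "(\<Sum>x\<leftarrow>nths L S. frob (branch_out V x)) \<le> frob V" if "V \<in> carrier_mat dA dB" for V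
    proof -
      have "(\<Sum>x\<leftarrow>nths L S. frob (branch_out V x)) \<le> (\<Sum>x\<leftarrow>L. frob (branch_out V x))"
        by (rule sum_list_nths_le) (rule frob_nonneg)
      also have "\<dots> = frob V"
        using bspec[OF conjunct2[OF locc_dims_frob[OF L]] that] by (simp only: case_prod_unfold)
      finally show ?thesis .
    qed
  qed (rule E)
qed

section \<open>Two copies of a two-qubit pure state\<close>

lemma sum_lessThan_4: "sum f {..<4} = f 0 + f 1 + f 2 + f (3 :: nat)" for f :: "nat \<Rightarrow> 'a :: comm_monoid_add"
  by (simp add: eval_nat_numeral)

lemma less_4_cases: "i < 4 \<Longrightarrow> i = 0 \<or> i = 1 \<or> i = 2 \<or> i = (3 :: nat)"
  by linarith

text \<open>Coefficient matrix of \<open>v\<close> tensor \<open>v\<close> across the cut AA'|BB':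
  the row encodes Alice's two bits, the column Bob's, and each copy takes one bit from either
  side.\<close>

definition pair_mat :: "complex vec \<Rightarrow> complex mat" where
  "pair_mat v = mat 4 4 (\<lambda>(i, j). v $ ((i div 2) * 2 + j div 2) * v $ ((i mod 2) * 2 + j mod 2))"

lemma copies_2_proj:
  assumes "v \<in> carrier_vec 4"
  shows "copies 2 (proj v) = proj (vectorize (pair_mat v))"
proof -
  have *: "r div 2 * 2 + r mod 2 = r" for r :: nat by simp
  \<comment> \<open>The recursion for \<open>copies\<close> ends in a one-dimensional factor, whose
    attachment leaves all indices unchanged.\<close>
  have 1: "copies 1 (proj v) = proj v"
    using assms
    by (intro eq_matI) (auto simp: cut_tensor_def proj_def cut_fst_def cut_snd_def *)
  have bounds: "r div 4 div 2 * 2 + r mod 4 div 2 < 4 \<and> r div 4 mod 2 * 2 + r mod 4 mod 2 < 4 \<and> r div 4 < 4"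
    if "r < 16" for r :: nat
  proof -
    have *: "a div 2 * 2 + b div 2 < 4 \<and> a mod 2 * 2 + b mod 2 < 4" if "a < 4" "b < 4" for a b :: nat
      using less_4_cases[OF that(1)] less_4_cases[OF that(2)] by auto
    have "r div 4 < 4" using that by simp
    then show ?thesis using *[of "r div 4" "r mod 4"] by simp
  qed
  have "copies 2 (proj v) = cut_tensor 2 2 2 2 (proj v) (copies 1 (proj v))"
    by (simp add: numeral_2_eq_2)
  also have "\<dots> = proj (vectorize (pair_mat v))"
    unfolding 1 using assms bounds
    by (intro eq_matI) (auto simp: cut_tensor_def proj_def cut_fst_def cut_snd_def pair_mat_def)
  finally show ?thesis .
qed

lemma pair_mat_carrier: "pair_mat v \<in> carrier_mat 4 4"
  by (simp add: pair_mat_def)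

lemma copies_2_carrier: "v \<in> carrier_vec 4 \<Longrightarrow> copies 2 (proj v) \<in> carrier_mat (4 * 4) (4 * 4)"
  using pair_mat_carrier[of v] unfolding copies_2_proj by (simp add: proj_def)

section \<open>Branches of conclusive maps\<close>

lemma sum_list_quadratic:
  fixes a b c d :: "'a \<Rightarrow> complex"
  shows "(\<Sum>x\<leftarrow>L. a x * cnj (a x)) + (\<Sum>x\<leftarrow>L. d x * cnj (d x))
      - (\<Sum>x\<leftarrow>L. a x * cnj (d x)) - (\<Sum>x\<leftarrow>L. d x * cnj (a x))
      + 2 * (\<Sum>x\<leftarrow>L. b x * cnj (b x)) + 2 * (\<Sum>x\<leftarrow>L. c x * cnj (c x))
    = complex_of_real (\<Sum>x\<leftarrow>L. (cmod (a x - d x))\<^sup>2 + 2 * (cmod (b x))\<^sup>2 + 2 * (cmod (c x))\<^sup>2)"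
proof (induction L)
  case Nil
  then show ?case by simp
next
  case (Cons x L)
  have "complex_of_real ((cmod (a x - d x))\<^sup>2 + 2 * (cmod (b x))\<^sup>2 + 2 * (cmod (c x))\<^sup>2)
      = (a x - d x) * cnj (a x - d x) + 2 * (b x * cnj (b x)) + 2 * (c x * cnj (c x))"
    by (simp add: complex_norm_square del: of_real_power complex_cnj_diff)
  then show ?case
    unfolding list.map sum_list.Cons of_real_add[of _ "sum_list _"] Cons.IH[symmetric]
    by (simp add: algebra_simps del: of_real_power)
qed

text \<open>Equality of overlap and trace says that the output has no weight orthogonal to
  \<open>phi_plus\<close>. That weight is a sum of nonnegative branch contributions, so every single
  branch outputs a multiple of \<open>phi_plus\<close>, that is, a scalar coefficient
  matrix.\<close>

lemma conclusive_branch: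
  assumes dims: "\<And>A B. (A, B) \<in> set L \<Longrightarrow> A \<in> carrier_mat 2 dA \<and> B \<in> carrier_mat 2 dB"
    and V: "V \<in> carrier_mat dA dB"
    and X: "X = kraus_map 2 2 L (proj (vectorize V))"
    and concl: "(X *\<^sub>v phi_plus) \<bullet>c phi_plus = mat_trace X"
    and x: "x \<in> set L"
  shows "branch_out V x $$ (0, 1) = 0" "branch_out V x $$ (1, 0) = 0"
    "branch_out V x $$ (0, 0) = branch_out V x $$ (1, 1)"
proof -
  define w where "w = (\<lambda>x i j. branch_out V x $$ (i, j))"
  \<comment> \<open>Twice the squared distance of the branch output from the line spanned by
    \<open>phi_plus\<close>.\<close>
  define d where "d = (\<lambda>x. (cmod (w x 0 0 - w x 1 1))\<^sup>2 + 2 * (cmod (w x 0 1))\<^sup>2 + 2 * (cmod (w x 1 0))\<^sup>2)"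
  have X': "X = mat 4 4 (\<lambda>(p, q). \<Sum>x\<leftarrow>L. w x (p div 2) (p mod 2) * cnj (w x (q div 2) (q mod 2)))"
    unfolding X w_def by (subst kraus_map_proj[OF dims V]) simp_all
  then have XC: "X \<in> carrier_mat 4 4" by simp
  then have tr: "mat_trace X = X $$ (0, 0) + X $$ (1, 1) + X $$ (2, 2) + X $$ (3, 3)"
    by (simp add: mat_trace_def sum_lessThan_4)
  have s: "complex_of_real (sqrt 2) * complex_of_real (sqrt 2) = 2"
    by (simp flip: of_real_mult)
  have "(X *\<^sub>v phi_plus) \<bullet>c phi_plus = (X $$ (0, 0) + X $$ (0, 3) + X $$ (3, 0) + X $$ (3, 3)) / 2"
    using s XC
    by (simp add: phi_plus_def scalar_prod_def atLeast0LessThan sum_lessThan_4 vec_of_list_index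
        numeral_3_eq_3 field_simps)
  \<comment> \<open>Twice the trace minus twice the overlap.\<close>
  with concl tr have "X $$ (0, 0) + X $$ (3, 3) - X $$ (0, 3) - X $$ (3, 0) + 2 * X $$ (1, 1) + 2 * X $$ (2, 2) = 0"
    by (simp add: field_simps)
  also have "X $$ (0, 0) + X $$ (3, 3) - X $$ (0, 3) - X $$ (3, 0) + 2 * X $$ (1, 1) + 2 * X $$ (2, 2)
      = complex_of_real (\<Sum>x\<leftarrow>L. d x)"
    unfolding d_def sum_list_quadratic[symmetric, where a = "\<lambda>x. w x 0 0" and b = "\<lambda>x. w x 0 1"
        and c = "\<lambda>x. w x 1 0" and d = "\<lambda>x. w x 1 1"]
    by (simp add: X')
  finally have "(\<Sum>x\<leftarrow>L. d x) = 0"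
    by (simp only: of_real_eq_0_iff)
  then have "d x = 0"
    using x by (subst (asm) sum_list_nonneg_eq_0_iff) (auto simp: d_def)
  then have "cmod (w x 0 0 - w x 1 1) = 0 \<and> cmod (w x 0 1) = 0 \<and> cmod (w x 1 0) = 0"
    unfolding d_def by (smt (verit) zero_le_power2 power_eq_0_iff)
  then show "branch_out V x $$ (0, 1) = 0" "branch_out V x $$ (1, 0) = 0"
    "branch_out V x $$ (0, 0) = branch_out V x $$ (1, 1)"
    unfolding w_def by auto
qed

section \<open>Stage 2\<close>

lemma frob_2:
  "V \<in> carrier_mat 2 2 \<Longrightarrow> frob V =
    (cmod (V $$ (0, 0)))\<^sup>2 + (cmod (V $$ (0, 1)))\<^sup>2 + (cmod (V $$ (1, 0)))\<^sup>2 + (cmod (V $$ (1, 1)))\<^sup>2"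
  by (auto simp: frob_def numeral_2_eq_2)

lemma schmidt_ket_carrier: "schmidt_ket \<alpha> \<beta> \<in> carrier_vec 4"
  by (simp add: schmidt_ket_def carrier_vecI)

lemma index_schmidt_ket [simp]:
  "schmidt_ket \<alpha> \<beta> $ 0 = \<alpha>" "schmidt_ket \<alpha> \<beta> $ Suc 0 = 0"
  "schmidt_ket \<alpha> \<beta> $ 2 = 0" "schmidt_ket \<alpha> \<beta> $ 3 = \<beta>"
  "schmidt_ket \<alpha> \<beta> $ Suc (Suc 0) = 0" "schmidt_ket \<alpha> \<beta> $ Suc (Suc (Suc 0)) = \<beta>"
  by (simp_all add: schmidt_ket_def vec_of_list_index numeral_2_eq_2 numeral_3_eq_3)

text \<open>The coefficient matrix of the two copies is diagonal with entries \<alpha>^2,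
  \<alpha>\<beta>, \<alpha>\<beta>, \<beta>^2.\<close>

lemma index_pair_schmidt:
  assumes "A \<in> carrier_mat eA 4" "B \<in> carrier_mat eB 4" "p < eA" "q < eB"
  shows "(A * pair_mat (schmidt_ket \<alpha> \<beta>) * transpose_mat B) $$ (p, q) =
    \<alpha>\<^sup>2 * (A $$ (p, 0) * B $$ (q, 0)) + \<alpha> * \<beta> * (A $$ (p, 1) * B $$ (q, 1) + A $$ (p, 2) * B $$ (q, 2))
      + \<beta>\<^sup>2 * (A $$ (p, 3) * B $$ (q, 3))"
  by (subst index_sandwich[OF assms(1,2) pair_mat_carrier assms(3,4)])
    (simp add: sum_lessThan_4 pair_mat_def power2_eq_square algebra_simps)

text \<open>The components along \<open>|00,00>\<close> and \<open>|11,11>\<close> cannot contribute to a conclusive branch: this is all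
  that such a branch sees of the two copies, up to the factor \<open>\<alpha> \<beta>\<close>.\<close>

definition mid_mat :: "complex mat" where
  "mid_mat = mat 4 4 (\<lambda>(i, j). if i = j \<and> (i = 1 \<or> i = 2) then 1 else 0)"

lemma mid_mat_carrier: "mid_mat \<in> carrier_mat 4 4"
  by (simp add: mid_mat_def)

lemma frob_mid_mat: "frob mid_mat = 2"
  by (simp add: frob_def mid_mat_def sum_lessThan_4)

lemma index_mid_mat:
  assumes "A \<in> carrier_mat eA 4" "B \<in> carrier_mat eB 4" "p < eA" "q < eB"
  shows "(A * mid_mat * transpose_mat B) $$ (p, q) =
    A $$ (p, 1) * B $$ (q, 1) + A $$ (p, 2) * B $$ (q, 2)"
  by (subst index_sandwich[OF assms(1,2) mid_mat_carrier assms(3,4)])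
    (simp add: sum_lessThan_4 mid_mat_def)

text \<open>The outer product of (a, b) and (c, d) has rank at most one, so it cannot be a nonzero
  multiple of the identity. Concretely, a or d vanishes, and with it one side of the second
  equation.\<close>

lemma offdiag_rank_one_eq_0:
  fixes a b c d :: complex
  assumes "a * d = 0" "a * c = b * d"
  shows "a * c = 0"
  using assms by (metis mult_zero_left mult_eq_0_iff)

lemma stage2_bound:
  assumes E: "universal_conclusive_ecp 2 known_basis_states E"
    and norm: "(cmod \<alpha>)\<^sup>2 + (cmod \<beta>)\<^sup>2 = 1"
  shows "Re (mat_trace (E (copies 2 (proj (schmidt_ket \<alpha> \<beta>))))) \<le> 2 * (cmod (\<alpha> * \<beta>))\<^sup>2"
proof -
  have br: "locc_branch 4 4 2 2 E"
    using E by (simp add: universal_conclusive_ecp_def)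
  obtain T where dims: "\<And>A B. (A, B) \<in> set T \<Longrightarrow> A \<in> carrier_mat 2 4 \<and> B \<in> carrier_mat 2 4"
    and ET: "\<And>\<rho>. \<rho> \<in> carrier_mat (4 * 4) (4 * 4) \<Longrightarrow> E \<rho> = kraus_map 2 2 T \<rho>"
    and le: "\<And>V. V \<in> carrier_mat 4 4 \<Longrightarrow> (\<Sum>x\<leftarrow>T. frob (branch_out V x)) \<le> frob V"
    using locc_branchE[OF br] by blast
  have E_eq: "E (copies 2 (proj (schmidt_ket \<alpha> \<beta>))) =
      kraus_map 2 2 T (proj (vectorize (pair_mat (schmidt_ket \<alpha> \<beta>))))" for \<alpha> \<beta>
    using ET[OF copies_2_carrier[OF schmidt_ket_carrier]] by (simp only: copies_2_proj[OF schmidt_ket_carrier])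
  \<comment> \<open>The amplitudes are quantified afresh: universality is needed at the two product
    inputs, not only at the given state.\<close>
  have concl: "branch_out (pair_mat (schmidt_ket \<alpha> \<beta>)) x $$ (0, 1) = 0
      \<and> branch_out (pair_mat (schmidt_ket \<alpha> \<beta>)) x $$ (1, 0) = 0
      \<and> branch_out (pair_mat (schmidt_ket \<alpha> \<beta>)) x $$ (0, 0) = branch_out (pair_mat (schmidt_ket \<alpha> \<beta>)) x $$ (1, 1)"
    if "(cmod \<alpha>)\<^sup>2 + (cmod \<beta>)\<^sup>2 = 1" "x \<in> set T" for \<alpha> \<beta> x
  proof -
    have "(E (copies 2 (proj (schmidt_ket \<alpha> \<beta>))) *\<^sub>v phi_plus) \<bullet>c phi_plus
        = mat_trace (E (copies 2 (proj (schmidt_ket \<alpha> \<beta>))))"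
      using E that(1) unfolding universal_conclusive_ecp_def known_basis_states_def by blast
    then show ?thesis
      using conclusive_branch[OF dims pair_mat_carrier E_eq _ that(2)] by blast
  qed
  have branch: "frob (branch_out (pair_mat (schmidt_ket \<alpha> \<beta>)) x)
      = (cmod (\<alpha> * \<beta>))\<^sup>2 * frob (branch_out mid_mat x)" if x: "x \<in> set T" for x
  proof -
    obtain A B where AB: "x = (A, B)" by (rule prod.exhaust)
    have A: "A \<in> carrier_mat 2 4" and B: "B \<in> carrier_mat 2 4"
      using dims x AB by auto
    note idx = index_pair_schmidt[OF A B]
    \<comment> \<open>At \<alpha> = 1, \<beta> = 0 only this outer product remains in the branch
      output, and conclusiveness forces it to vanish.\<close>
    have z0: "A $$ (p, 0) * B $$ (q, 0) = 0" if "p < 2" "q < 2" for p q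
    proof -
      have "A $$ (0, 0) * B $$ (1, 0) = 0" "A $$ (1, 0) * B $$ (0, 0) = 0"
        "A $$ (0, 0) * B $$ (0, 0) = A $$ (1, 0) * B $$ (1, 0)"
        using concl[of 1 0, OF _ x] by (simp_all add: AB idx del: assoc_mult_mat index_mult_mat(1) mult_eq_0_iff)
      moreover have "A $$ (0, 0) * B $$ (0, 0) = 0"
        using offdiag_rank_one_eq_0 calculation by blast
      ultimately show ?thesis using that by (auto simp: less_2_cases_iff)
    qed
    \<comment> \<open>The same argument at \<alpha> = 0, \<beta> = 1.\<close>
    have z3: "A $$ (p, 3) * B $$ (q, 3) = 0" if "p < 2" "q < 2" for p q
    proof -
      have "A $$ (0, 3) * B $$ (1, 3) = 0" "A $$ (1, 3) * B $$ (0, 3) = 0"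
        "A $$ (0, 3) * B $$ (0, 3) = A $$ (1, 3) * B $$ (1, 3)"
        using concl[of 0 1, OF _ x] by (simp_all add: AB idx del: assoc_mult_mat index_mult_mat(1) mult_eq_0_iff)
      moreover have "A $$ (0, 3) * B $$ (0, 3) = 0"
        using offdiag_rank_one_eq_0 calculation by blast
      ultimately show ?thesis using that by (auto simp: less_2_cases_iff)
    qed
    have eq: "branch_out (pair_mat (schmidt_ket \<alpha> \<beta>)) x $$ (p, q) = \<alpha> * \<beta> * branch_out mid_mat x $$ (p, q)"
      if "p < 2" "q < 2" for p q
      by (simp only: AB fst_conv snd_conv idx[OF that] index_mid_mat[OF A B that] z0[OF that] z3[OF that]) simp
    have car: "branch_out V x \<in> carrier_mat 2 2" if "V \<in> carrier_mat 4 4" for V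
      unfolding AB fst_conv snd_conv
      by (rule mult_carrier_mat[OF mult_carrier_mat[OF A that]]) (use B in simp)
    show ?thesis
      unfolding frob_2[OF car[OF pair_mat_carrier]] frob_2[OF car[OF mid_mat_carrier]]
      by (simp add: eq norm_mult power_mult_distrib algebra_simps del: assoc_mult_mat index_mult_mat(1))
  qed
  have "Re (mat_trace (E (copies 2 (proj (schmidt_ket \<alpha> \<beta>))))) =
      (\<Sum>x\<leftarrow>T. frob (branch_out (pair_mat (schmidt_ket \<alpha> \<beta>)) x))"
    unfolding E_eq by (subst mat_trace_kraus_map[OF dims pair_mat_carrier]) simp_all
  also have "\<dots> = (\<Sum>x\<leftarrow>T. (cmod (\<alpha> * \<beta>))\<^sup>2 * frob (branch_out mid_mat x))"
    by (intro arg_cong[where f = sum_list] map_cong refl) (rule branch)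
  also have "\<dots> = (cmod (\<alpha> * \<beta>))\<^sup>2 * (\<Sum>x\<leftarrow>T. frob (branch_out mid_mat x))"
    by (rule sum_list_const_mult)
  \<comment> \<open>Trace non-increase is applied to the unnormalized \<open>mid_mat\<close>; its
    squared norm is the constant 2 of the bound.\<close>
  also have "\<dots> \<le> (cmod (\<alpha> * \<beta>))\<^sup>2 * 2"
    using le[OF mid_mat_carrier] by (intro mult_left_mono) (simp_all add: frob_mid_mat)
  finally show ?thesis by simp
qed

section \<open>Stage 1\<close>

lemma stage1_op_carrier: "stage1_op a b \<in> carrier_mat 4 4"
  by (intro carrier_matI) (simp_all add: stage1_op_def mat_of_rows_list_def)

lemma index_stage1_op:
  assumes "i < 4" "j < 4"
  shows "stage1_op a b $$ (i, j) =
    (if i = 0 \<and> (j = 1 \<or> j = 2) then a else if i = 2 \<and> j = 1 then b else if i = 2 \<and> j = 2 then - b else 0)"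
  using less_4_cases[OF assms(1)] less_4_cases[OF assms(2)]
  by (auto simp: stage1_op_def mat_of_rows_list_def numeral_2_eq_2 numeral_3_eq_3)

text \<open>On either side only the indices 1 and 2, for |01> and |10>, are seen: output index 0
  takes \<open>a\<close> times their sum, output index 2 takes \<open>b\<close> times their
  difference.\<close>

lemma index_stage1_sandwich:
  assumes "V \<in> carrier_mat 4 4" "p < 4" "q < 4"
  shows "(stage1_op a b * V * transpose_mat (stage1_op a b)) $$ (p, q) =
    (if p = 0 \<and> q = 0 then a\<^sup>2 * (V $$ (1, 1) + V $$ (1, 2) + V $$ (2, 1) + V $$ (2, 2))
     else if p = 0 \<and> q = 2 then a * b * (V $$ (1, 1) - V $$ (1, 2) + V $$ (2, 1) - V $$ (2, 2))
     else if p = 2 \<and> q = 0 then a * b * (V $$ (1, 1) + V $$ (1, 2) - V $$ (2, 1) - V $$ (2, 2))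
     else if p = 2 \<and> q = 2 then b\<^sup>2 * (V $$ (1, 1) - V $$ (1, 2) - V $$ (2, 1) + V $$ (2, 2))
     else 0)"
  using less_4_cases[OF assms(2)] less_4_cases[OF assms(3)]
  unfolding index_sandwich[OF stage1_op_carrier stage1_op_carrier assms]
  by (elim disjE) (simp_all add: sum_lessThan_4 index_stage1_op power2_eq_square algebra_simps)

text \<open>The product vector of \<open>|01> + |10>\<close> (Alice) and \<open>|01> - |10>\<close> (Bob). Trace non-increase on it
  bounds the sum of \<open>|a b|\<^sup>2\<close> over all Kraus operators of Stage 1 by \<open>1/4\<close>.\<close>

definition probe_mat :: "complex mat" where
  "probe_mat = mat 4 4 (\<lambda>(i, j).
     (if i = 1 \<or> i = 2 then 1 else 0) * (if j = 1 then 1 else if j = 2 then - 1 else 0))"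

lemma probe_mat_carrier: "probe_mat \<in> carrier_mat 4 4"
  by (simp add: probe_mat_def)

lemma index_probe_mat:
  "probe_mat $$ (1, 1) = 1" "probe_mat $$ (1, 2) = - 1" "probe_mat $$ (2, 1) = 1" "probe_mat $$ (2, 2) = - 1"
  by (simp_all add: probe_mat_def)

lemma frob_probe_mat: "frob probe_mat = 4"
  by (simp add: frob_def probe_mat_def sum_lessThan_4)

text \<open>Alice's factor |01> + |10> is sent to 2a|00> and Bob's |01> - |10> to 2b|10>, leaving
  the single entry 4ab.\<close>

lemma frob_stage1_probe:
  "frob (stage1_op a b * probe_mat * transpose_mat (stage1_op a b)) = 16 * (cmod a)\<^sup>2 * (cmod b)\<^sup>2"
proof -
  have "stage1_op a b * probe_mat * transpose_mat (stage1_op a b) \<in> carrier_mat 4 4"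
    by (rule mult_carrier_mat[OF mult_carrier_mat[OF stage1_op_carrier probe_mat_carrier]])
      (simp add: stage1_op_carrier)
  then have d: "dim_row (stage1_op a b * probe_mat * transpose_mat (stage1_op a b)) = 4"
     "dim_col (stage1_op a b * probe_mat * transpose_mat (stage1_op a b)) = 4"
    by (auto simp only: carrier_matD)
  have "frob (stage1_op a b * probe_mat * transpose_mat (stage1_op a b)) = (cmod (a * b * 4))\<^sup>2"
    unfolding frob_def d
    by (simp add: sum_lessThan_4 index_stage1_sandwich[OF probe_mat_carrier] index_probe_mat
        index_probe_mat[simplified] del: assoc_mult_mat index_mult_mat(1))
  then show ?thesis by (simp add: norm_mult power_mult_distrib)
qed

lemma stage1_kraus_form:
  assumes "stage1 Ks" "K \<in> set Ks"
  shows "\<exists>a b. K = stage1_op a b"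
proof -
  have "\<forall>K\<in>set Ks. \<exists>a b. a \<noteq> 0 \<and> b \<noteq> 0 \<and> 2 * (cmod a ^ 4 + cmod b ^ 4) \<le> 1 \<and> K = stage1_op a b"
    using assms(1) unfolding stage1_def by (elim conjE)
  with assms(2) show ?thesis by blast
qed

lemma stage1_dims:
  assumes "stage1 Ks" "(A, B) \<in> set (map (\<lambda>K. (K, K)) Ks)"
  shows "A \<in> carrier_mat 4 4 \<and> B \<in> carrier_mat 4 4"
  using assms(2) stage1_kraus_form[OF assms(1)] stage1_op_carrier by fastforce

text \<open>\<open>Ks\<close> may differ from the Kraus list of the LOCC protocol that realizes the
  map. Both represent the same map, so the traces of their outputs agree, and the bound carries
  over.\<close>

lemma stage1_probe_le:
  assumes "stage1 Ks"
  shows "(\<Sum>K\<leftarrow>Ks. frob (K * probe_mat * transpose_mat K)) \<le> 4"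
proof -
  have "locc_branch 4 4 4 4 (stage1_map Ks)"
    using assms by (simp add: stage1_def)
  then obtain T where dims: "\<And>A B. (A, B) \<in> set T \<Longrightarrow> A \<in> carrier_mat 4 4 \<and> B \<in> carrier_mat 4 4"
    and eq: "\<And>\<rho>. \<rho> \<in> carrier_mat (4 * 4) (4 * 4) \<Longrightarrow> stage1_map Ks \<rho> = kraus_map 4 4 T \<rho>"
    and le: "\<And>V. V \<in> carrier_mat 4 4 \<Longrightarrow> (\<Sum>x\<leftarrow>T. frob (branch_out V x)) \<le> frob V"
    using locc_branchE by blast
  have "proj (vectorize probe_mat) \<in> carrier_mat (4 * 4) (4 * 4)"
    using probe_mat_carrier by (simp add: proj_def)
  from eq[OF this] have "mat_trace (kraus_map 4 4 (map (\<lambda>K. (K, K)) Ks) (proj (vectorize probe_mat)))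
      = mat_trace (kraus_map 4 4 T (proj (vectorize probe_mat)))"
    by (simp only: stage1_map_def)
  then have "(\<Sum>x\<leftarrow>map (\<lambda>K. (K, K)) Ks. frob (branch_out probe_mat x))
      = (\<Sum>x\<leftarrow>T. frob (branch_out probe_mat x))"
    by (simp only: mat_trace_kraus_map[OF dims probe_mat_carrier]
      mat_trace_kraus_map[OF stage1_dims[OF assms] probe_mat_carrier] of_real_eq_iff)
  with le[OF probe_mat_carrier] show ?thesis
    by (simp only: frob_probe_mat map_map o_def fst_conv snd_conv)
qed

text \<open>The entry (0, 3) is the coherence between |00> and |11>. The triangle inequality over
  the Kraus operators leaves a sum of |ab|^2, which the probe vector controls.\<close>

lemma discard_stage1_offdiag:
  assumes st: "stage1 Ks" and \<psi>: "\<psi> = vec_of_list [c1, c2, c3, c4]"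
  shows "cmod (discard_snd 2 2 2 2 (stage1_map Ks (copies 2 (proj \<psi>))) $$ (0, 3))
    \<le> cmod ((c1 * c4 + c2 * c3) * (c1 * c4 - c2 * c3))"
proof -
  let ?V = "pair_mat \<psi>"
  let ?m = "cmod ((c1 * c4 + c2 * c3) * (c1 * c4 - c2 * c3))"
  have \<psi>C: "\<psi> \<in> carrier_vec 4" by (simp add: \<psi> carrier_vecI)
  have V: "?V $$ (1, 1) = c1 * c4" "?V $$ (1, 2) = c2 * c3" "?V $$ (2, 1) = c2 * c3" "?V $$ (2, 2) = c1 * c4"
    by (simp_all add: pair_mat_def \<psi> vec_of_list_index numeral_2_eq_2 numeral_3_eq_3)
  define w where "w = (\<lambda>K p q. (K * ?V * transpose_mat K) $$ (p, q))"
  \<comment> \<open>For two equal copies the coefficient matrix satisfies V11 = V22 and V12 = V21,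
    so the mixed sum-difference entries cancel.\<close>
  have zero: "w K p q = 0" if "K \<in> set Ks" "p < 4" "q < 4" "\<not> (p = 0 \<and> q = 0)" "\<not> (p = 2 \<and> q = 2)" for K p q
  proof -
    obtain a b where "K = stage1_op a b" using stage1_kraus_form[OF st \<open>K \<in> set Ks\<close>] by blast
    then show ?thesis
      using that(4,5) by (auto simp add: w_def index_stage1_sandwich[OF pair_mat_carrier that(2,3)] V[unfolded One_nat_def]
        simp del: assoc_mult_mat index_mult_mat(1))
  qed
  \<comment> \<open>The product has modulus 4|ab|^2 \<open>?m\<close>, and the probe gives 16|ab|^2;
    hence the factor 1/4.\<close>
  have bound: "cmod (w K 0 0 * cnj (w K 2 2)) = ?m / 4 * frob (K * probe_mat * transpose_mat K)"
    if "K \<in> set Ks" for K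
  proof -
    obtain a b where K: "K = stage1_op a b" using stage1_kraus_form[OF st \<open>K \<in> set Ks\<close>] by blast
    have "w K 0 0 = a\<^sup>2 * (2 * (c1 * c4 + c2 * c3))" "w K 2 2 = b\<^sup>2 * (2 * (c1 * c4 - c2 * c3))"
      by (auto simp add: K w_def index_stage1_sandwich[OF pair_mat_carrier] V[unfolded One_nat_def]
        simp del: assoc_mult_mat index_mult_mat(1))
    then have "cmod (w K 0 0) = (cmod a)\<^sup>2 * (2 * cmod (c1 * c4 + c2 * c3))"
        "cmod (w K 2 2) = (cmod b)\<^sup>2 * (2 * cmod (c1 * c4 - c2 * c3))"
      by (simp_all only: norm_mult norm_power norm_numeral)
    then show ?thesis
      unfolding K frob_stage1_probe by (simp add: norm_mult)
  qed
  have X: "stage1_map Ks (copies 2 (proj \<psi>)) =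
      mat 16 16 (\<lambda>(p, q). \<Sum>K\<leftarrow>Ks. w K (p div 4) (p mod 4) * cnj (w K (q div 4) (q mod 4)))"
    unfolding stage1_map_def copies_2_proj[OF \<psi>C]
    by (subst kraus_map_proj[OF stage1_dims[OF st] pair_mat_carrier])
      (simp_all add: o_def w_def del: assoc_mult_mat index_mult_mat(1))
  have z: "(\<Sum>K\<leftarrow>Ks. w K p q * cnj (f K)) = 0" if "p < 4" "q < 4" "\<not> (p = 0 \<and> q = 0)" "\<not> (p = 2 \<and> q = 2)"
    for p q f
  proof -
    have "map (\<lambda>K. w K p q * cnj (f K)) Ks = map (\<lambda>K. 0) Ks"
      using zero[OF _ that] by simp
    then show ?thesis by (simp only: sum_list_0)
  qed
  \<comment> \<open>Only the garbage index q = 0 survives: |00> and |11> on AB then sit at the pair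
    indices (0, 0) and (2, 2).\<close>
  have "discard_snd 2 2 2 2 (stage1_map Ks (copies 2 (proj \<psi>))) $$ (0, 3) = (\<Sum>K\<leftarrow>Ks. w K 0 0 * cnj (w K 2 2))"
    by (simp add: discard_snd_def sum_lessThan_4 X cut_index_def z)
  also have "cmod \<dots> \<le> (\<Sum>K\<leftarrow>Ks. cmod (w K 0 0 * cnj (w K 2 2)))"
    by (induction Ks) (auto intro: norm_triangle_le)
  also have "\<dots> = (\<Sum>K\<leftarrow>Ks. ?m / 4 * frob (K * probe_mat * transpose_mat K))"
    by (intro arg_cong[where f = sum_list] map_cong refl) (rule bound)
  also have "\<dots> = ?m / 4 * (\<Sum>K\<leftarrow>Ks. frob (K * probe_mat * transpose_mat K))"
    by (rule sum_list_const_mult)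
  also have "\<dots> \<le> ?m / 4 * 4"
    using stage1_probe_le[OF st] by (rule mult_left_mono) simp
  finally show ?thesis by simp
qed

section \<open>Discarding the product garbage\<close>

lemma sum_lessThan_16:
  fixes f :: "nat \<Rightarrow> 'a :: comm_monoid_add"
  shows "sum f {..<16} = f 0 + f 1 + f 2 + f 3 + f 4 + f 5 + f 6 + f 7
    + f 8 + f 9 + f 10 + f 11 + f 12 + f 13 + f 14 + f 15"
  by (simp add: eval_nat_numeral)

text \<open>The garbage vector is a product of unit vectors, hence a unit vector, and tracing it out
  contributes the factor 1.\<close>

lemma discard_product_garbage:
  assumes g: "g \<in> carrier_vec 2" "g \<bullet>c g = 1" and h: "h \<in> carrier_vec 2" "h \<bullet>c h = 1"
    and X_def: "X = cut_tensor 2 2 2 2 (proj (schmidt_ket \<alpha> \<beta>)) (proj (vec_kron g h))"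
  shows "discard_snd 2 2 2 2 X = proj (schmidt_ket \<alpha> \<beta>)"
    and "mat_trace X = complex_of_real ((cmod \<alpha>)\<^sup>2 + (cmod \<beta>)\<^sup>2)"
proof -
  define k where "k = vec_kron g h"
  have k: "k \<in> carrier_vec 4"
    using g h by (intro carrier_vecI) (simp add: k_def vec_kron_def)
  have G: "g $ 0 * cnj (g $ 0) + g $ 1 * cnj (g $ 1) = 1" "h $ 0 * cnj (h $ 0) + h $ 1 * cnj (h $ 1) = 1"
    using g h by (simp_all add: scalar_prod_def numeral_2_eq_2)
  have "(\<Sum>q<4. k $ q * cnj (k $ q))
      = (g $ 0 * cnj (g $ 0) + g $ 1 * cnj (g $ 1)) * (h $ 0 * cnj (h $ 0) + h $ 1 * cnj (h $ 1))"
    using g h by (simp add: sum_lessThan_4 k_def vec_kron_def algebra_simps)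
  then have norm: "(\<Sum>q<4. k $ q * cnj (k $ q)) = 1" using G by simp
  have s: "schmidt_ket \<alpha> \<beta> \<in> carrier_vec 4" by (rule schmidt_ket_carrier)
  have inv: "cut_index 2 2 2 p q < 16 \<and> cut_fst 2 2 2 (cut_index 2 2 2 p q) = p \<and> cut_snd 2 2 2 (cut_index 2 2 2 p q) = q"
    if "p < 4" "q < 4" for p q
    using less_4_cases[OF that(1)] less_4_cases[OF that(2)]
    by (auto simp: cut_index_def cut_fst_def cut_snd_def)
  have Xi: "X $$ (cut_index 2 2 2 p q, cut_index 2 2 2 p' q) =
      schmidt_ket \<alpha> \<beta> $ p * cnj (schmidt_ket \<alpha> \<beta> $ p') * (k $ q * cnj (k $ q))" if "p < 4" "p' < 4" "q < 4" for p p' q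
    using inv that s k by (simp add: X_def cut_tensor_def proj_def flip: k_def)
  have "discard_snd 2 2 2 2 X $$ (p, p') = proj (schmidt_ket \<alpha> \<beta>) $$ (p, p')" if "p < 4" "p' < 4" for p p'
  proof -
    have "discard_snd 2 2 2 2 X $$ (p, p') =
        schmidt_ket \<alpha> \<beta> $ p * cnj (schmidt_ket \<alpha> \<beta> $ p') * (\<Sum>q<4. k $ q * cnj (k $ q))"
      using that by (simp add: discard_snd_def Xi sum_distrib_left)
    then show ?thesis using that s by (simp add: norm proj_def)
  qed
  then show disc: "discard_snd 2 2 2 2 X = proj (schmidt_ket \<alpha> \<beta>)"
    using s by (intro eq_matI) (auto simp: discard_snd_def proj_def)
  have "mat_trace X = (\<Sum>r<16. X $$ (r, r))"
    by (simp add: mat_trace_def X_def cut_tensor_def)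
  \<comment> \<open>\<open>cut_index\<close> permutes the sixteen diagonal positions; the
    permutation is checked by enumeration.\<close>
  also have "\<dots> = (\<Sum>p<4. \<Sum>q<4. X $$ (cut_index 2 2 2 p q, cut_index 2 2 2 p q))"
    by (simp add: sum_lessThan_16 sum_lessThan_4 cut_index_def add_ac, simp add: numeral_2_eq_2 numeral_3_eq_3)
  also have "\<dots> = mat_trace (discard_snd 2 2 2 2 X)"
    by (simp add: mat_trace_def discard_snd_def)
  also have "\<dots> = complex_of_real ((cmod \<alpha>)\<^sup>2 + (cmod \<beta>)\<^sup>2)"
    unfolding disc using s by (simp add: mat_trace_def proj_def sum_lessThan_4 complex_norm_square
        del: of_real_power)
  finally show "mat_trace X = complex_of_real ((cmod \<alpha>)\<^sup>2 + (cmod \<beta>)\<^sup>2)" .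
qed

section \<open>Closed form of the bound and combination of the two stages\<close>

lemma bound_eq:
  "2 * cmod (c2 ^ 4 * c3 ^ 4) + 2 * cmod (c1 ^ 4 * c4 ^ 4) - 4 * Re (c1\<^sup>2 * c4\<^sup>2 * (cnj c2)\<^sup>2 * (cnj c3)\<^sup>2)
    = 2 * (cmod ((c1 * c4 + c2 * c3) * (c1 * c4 - c2 * c3)))\<^sup>2"
proof -
  \<comment> \<open>The product of sum and difference of c1 c4 and c2 c3 is u - v, and the bound is
    the expansion of 2|u - v|^2.\<close>
  define u v where "u = (c1 * c4)\<^sup>2" and "v = (c2 * c3)\<^sup>2"
  have "(cmod (u - v))\<^sup>2 = (cmod u)\<^sup>2 + (cmod v)\<^sup>2 - 2 * Re (u * cnj v)"
    unfolding cmod_power2 by (simp add: power2_eq_square algebra_simps)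
  moreover have "(c1 * c4 + c2 * c3) * (c1 * c4 - c2 * c3) = u - v"
    by (simp add: u_def v_def power2_eq_square algebra_simps)
  moreover have "(cmod u)\<^sup>2 = cmod (c1 ^ 4 * c4 ^ 4)" "(cmod v)\<^sup>2 = cmod (c2 ^ 4 * c3 ^ 4)"
    by (simp_all add: u_def v_def norm_mult norm_power power_mult_distrib flip: power_mult)
  moreover have "u * cnj v = c1\<^sup>2 * c4\<^sup>2 * (cnj c2)\<^sup>2 * (cnj c3)\<^sup>2"
    by (simp add: u_def v_def power_mult_distrib)
  ultimately show ?thesis by simp
qed

theorem theorem3:
  fixes c\<^sub>1 c\<^sub>2 c\<^sub>3 c\<^sub>4 :: complex
    and Ks :: "complex mat list"
    and E :: "complex mat \<Rightarrow> complex mat"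
  assumes "(cmod c\<^sub>1)\<^sup>2 + (cmod c\<^sub>2)\<^sup>2 + (cmod c\<^sub>3)\<^sup>2 + (cmod c\<^sub>4)\<^sup>2 = 1"
    and "concatenated_ecp Ks E"
  shows "success_prob Ks E (vec_of_list [c\<^sub>1, c\<^sub>2, c\<^sub>3, c\<^sub>4])
    \<le> 2 * cmod (c\<^sub>2 ^ 4 * c\<^sub>3 ^ 4) + 2 * cmod (c\<^sub>1 ^ 4 * c\<^sub>4 ^ 4)
      - 4 * Re (c\<^sub>1\<^sup>2 * c\<^sub>4\<^sup>2 * (cnj c\<^sub>2)\<^sup>2 * (cnj c\<^sub>3)\<^sup>2)"
proof -
  define \<psi> where "\<psi> = vec_of_list [c\<^sub>1, c\<^sub>2, c\<^sub>3, c\<^sub>4]"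
  define m where "m = cmod ((c\<^sub>1 * c\<^sub>4 + c\<^sub>2 * c\<^sub>3) * (c\<^sub>1 * c\<^sub>4 - c\<^sub>2 * c\<^sub>3))"
  have st: "stage1 Ks" and ecp: "universal_conclusive_ecp 2 known_basis_states E"
    using assms(2) by (auto simp: concatenated_ecp_def)
  have \<psi>C: "\<psi> \<in> carrier_vec 4" by (simp add: \<psi>_def carrier_vecI)
  have "\<psi> \<bullet>c \<psi> = c\<^sub>1 * cnj c\<^sub>1 + c\<^sub>2 * cnj c\<^sub>2 + c\<^sub>3 * cnj c\<^sub>3 + c\<^sub>4 * cnj c\<^sub>4"
    by (simp add: \<psi>_def scalar_prod_def vec_of_list_index)
  also have "\<dots> = complex_of_real ((cmod c\<^sub>1)\<^sup>2 + (cmod c\<^sub>2)\<^sup>2 + (cmod c\<^sub>3)\<^sup>2 + (cmod c\<^sub>4)\<^sup>2)"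
    by (simp only: complex_norm_square of_real_add)
  finally have "\<psi> \<bullet>c \<psi> = 1" unfolding assms(1) by simp
  with st \<psi>C obtain \<alpha> \<beta> g h where g: "g \<in> carrier_vec 2" "g \<bullet>c g = 1" and h: "h \<in> carrier_vec 2" "h \<bullet>c h = 1"
    and X: "stage1_map Ks (copies 2 (proj \<psi>)) =
      cut_tensor 2 2 2 2 (proj (schmidt_ket \<alpha> \<beta>)) (proj (vec_kron g h))"
    unfolding stage1_def by blast
  define P where "P = (cmod \<alpha>)\<^sup>2 + (cmod \<beta>)\<^sup>2"
  have P: "stage1_prob Ks \<psi> = P"
    unfolding stage1_prob_def X discard_product_garbage(2)[OF g h refl] P_def by simp
  have out: "stage1_output Ks \<psi> = complex_of_real (1 / P) \<cdot>\<^sub>m proj (schmidt_ket \<alpha> \<beta>)"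
    unfolding stage1_output_def P X discard_product_garbage(1)[OF g h refl] ..
  \<comment> \<open>Comparing the two expressions for the coherence turns the Stage 1 estimate into
    a bound on the unnormalized amplitudes.\<close>
  have "cmod (proj (schmidt_ket \<alpha> \<beta>) $$ (0, 3)) \<le> m"
    using discard_stage1_offdiag[OF st \<psi>_def] unfolding X discard_product_garbage(1)[OF g h refl] m_def .
  moreover have "proj (schmidt_ket \<alpha> \<beta>) $$ (0, 3) = \<alpha> * cnj \<beta>"
    using schmidt_ket_carrier[of \<alpha> \<beta>] by (simp add: proj_def)
  ultimately have ab: "cmod (\<alpha> * \<beta>) \<le> m" by (simp add: norm_mult)
  have "success_prob Ks E \<psi> \<le> 2 * m\<^sup>2"
  proof (cases "P = 0")
    \<comment> \<open>The renormalized state is a default value here, but the factor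
      \<open>P\<^sup>2\<close> makes the total success probability zero.\<close>
    case True
    then show ?thesis by (simp add: success_prob_def P)
  next
    case False
    then have pos: "P > 0" by (simp add: P_def sum_power2_gt_zero_iff add_nonneg_eq_0_iff)
    \<comment> \<open>Dividing both amplitudes by the square root of \<open>P\<close> exhibits the
      renormalized output as the projection onto a unit Schmidt vector, as the Stage 2 bound
      requires.\<close>
    define s where "s = complex_of_real (sqrt P)"
    have s: "s * cnj s = complex_of_real P" "cmod s = sqrt P" "s \<noteq> 0"
      using pos by (auto simp: s_def simp flip: of_real_mult)
    have "stage1_output Ks \<psi> = proj (schmidt_ket (\<alpha> / s) (\<beta> / s))"
    proof -
      have "schmidt_ket (\<alpha> / s) (\<beta> / s) $ i = schmidt_ket \<alpha> \<beta> $ i / s" if "i < 4" for i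
        using less_4_cases[OF that] by auto
      moreover have "x / s * cnj (y / s) = complex_of_real (1 / P) * (x * cnj y)" for x y
        by (simp flip: s(1))
      ultimately have "schmidt_ket (\<alpha> / s) (\<beta> / s) $ i * cnj (schmidt_ket (\<alpha> / s) (\<beta> / s) $ j) =
        complex_of_real (1 / P) * (schmidt_ket \<alpha> \<beta> $ i * cnj (schmidt_ket \<alpha> \<beta> $ j))" if "i < 4" "j < 4" for i j
        using that by simp
      then show ?thesis
        unfolding out using schmidt_ket_carrier[of \<alpha> \<beta>] schmidt_ket_carrier[of "\<alpha> / s" "\<beta> / s"]
        by (intro eq_matI) (auto simp: proj_def)
    qed
    moreover have "(cmod (\<alpha> / s))\<^sup>2 + (cmod (\<beta> / s))\<^sup>2 = 1"
      using pos by (simp add: norm_divide s power_divide flip: add_divide_distrib P_def)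
    ultimately have "stage2_prob Ks E \<psi> \<le> 2 * (cmod (\<alpha> / s * (\<beta> / s)))\<^sup>2"
      using stage2_bound[OF ecp, of "\<alpha> / s" "\<beta> / s"] by (simp only: stage2_prob_def)
    \<comment> \<open>The normalization costs exactly the factor \<open>P\<^sup>2\<close> that the
      two Stage 1 successes contribute, so it cancels.\<close>
    also have "(cmod (\<alpha> / s * (\<beta> / s)))\<^sup>2 = (cmod (\<alpha> * \<beta>))\<^sup>2 / P\<^sup>2"
      using pos by (simp add: norm_divide norm_mult s power_divide)
    finally have "P\<^sup>2 * stage2_prob Ks E \<psi> \<le> P\<^sup>2 * (2 * ((cmod (\<alpha> * \<beta>))\<^sup>2 / P\<^sup>2))"
      by (rule mult_left_mono) simp
    also have "\<dots> = 2 * (cmod (\<alpha> * \<beta>))\<^sup>2" using pos by simp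
    also have "\<dots> \<le> 2 * m\<^sup>2" using ab by (simp add: power_mono)
    finally show ?thesis by (simp add: success_prob_def P)
  qed
  then show ?thesis unfolding bound_eq \<psi>_def m_def .
qed

end
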